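(* A disconnected finite poset $P$ is LE-symmetric if and only if $P=C_{n_1}+A_1$ for some positive integer $n_1$, i.e. $P$ is the disjoint union of a chain and a single element.
   Context: For a finite poset $P$ with $n$ elements, a linear extension is a list $(p_1,\dots,p_n)$ of all elements of $P$ such that $p_a<_P p_b$ implies $a<b$; ${\mathcal{L}}(P)$ is the set of these. For $1\le i\le n-1$, the Bender--Knuth move $t_i$ acts on ${\mathcal{L}}(P)$ by swapping $p_i,p_{i+1}$ if they are incomparable and fixing the list otherwise. $\mathcal{BK}_P$ is the subgroup of the symmetric group ${\mathfrak{S}}_{{\mathcal{L}}(P)}$ generated by $t_1,\dots,t_{n-1}$. $P$ is LE-symmetric if $\mathcal{BK}_P={\mathfrak{S}}_{{\mathcal{L}}(P)}$. $C_m$ denotes an $m$-element chain, $A_1$ a one-element poset, and $+$ disjoint union of posets. *)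

theory Defs
  imports "HOL-Algebra.Bij" "HOL-Algebra.Generated_Groups"
begin

text \<open>
  A poset is given by its reflexive order relation \<open>r\<close>, assumed to satisfy
  \<^term>\<open>Partial_order r\<close>; its set of elements is \<^term>\<open>Field r\<close>.
\<close>

definition linear_extensions :: "'a rel \<Rightarrow> 'a list set" where
  "linear_extensions r = {xs. distinct xs \<and> set xs = Field r \<and>
     (\<forall>a < length xs. \<forall>b < length xs.
        (xs ! a, xs ! b) \<in> r \<and> xs ! a \<noteq> xs ! b \<longrightarrow> a < b)}"

definition incomparable :: "'a rel \<Rightarrow> 'a \<Rightarrow> 'a \<Rightarrow> bool" where
  "incomparable r x y \<longleftrightarrow> (x, y) \<notin> r \<and> (y, x) \<notin> r"

text \<open>
  The index \<open>i\<close> of a move ranges over \<open>1, \<dots>, n - 1\<close>, whereas lists are indexed from \<open>0\<close>: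
  the entries \<open>p\<^sub>i\<close> and \<open>p\<^sub>i\<^sub>+\<^sub>1\<close> are \<open>xs ! (i - 1)\<close> and \<open>xs ! i\<close>. The move is restricted to
  the set of linear extensions because the elements of \<^const>\<open>BijGroup\<close> are
  extensional functions.
\<close>

definition bender_knuth :: "'a rel \<Rightarrow> nat \<Rightarrow> 'a list \<Rightarrow> 'a list" where
  "bender_knuth r i = (\<lambda>xs \<in> linear_extensions r.
     if incomparable r (xs ! (i - 1)) (xs ! i)
     then xs[i - 1 := xs ! i, i := xs ! (i - 1)] else xs)"

definition BK_group :: "'a rel \<Rightarrow> ('a list \<Rightarrow> 'a list) set" where
  "BK_group r = generate (BijGroup (linear_extensions r))
     {bender_knuth r i |i. 1 \<le> i \<and> i \<le> card (Field r) - 1}"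

definition LE_symmetric :: "'a rel \<Rightarrow> bool" where
  "LE_symmetric r \<longleftrightarrow> BK_group r = carrier (BijGroup (linear_extensions r))"

text \<open>
  The poset is the disjoint union of two nonempty posets, namely of its restrictions to
  \<open>A\<close> and \<open>B\<close>. In particular, the empty poset is not disconnected.
\<close>

definition disconnected_poset :: "'a rel \<Rightarrow> bool" where
  "disconnected_poset r \<longleftrightarrow> (\<exists>A B. A \<noteq> {} \<and> B \<noteq> {} \<and> A \<inter> B = {} \<and> A \<union> B = Field r \<and>
     r \<subseteq> A \<times> A \<union> B \<times> B)"

definition poset_iso :: "'a rel \<Rightarrow> 'b rel \<Rightarrow> bool" where
  "poset_iso r s \<longleftrightarrow> (\<exists>f. bij_betw f (Field r) (Field s) \<and>
     (\<forall>x \<in> Field r. \<forall>y \<in> Field r. (x, y) \<in> r \<longleftrightarrow> (f x, f y) \<in> s))"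

definition poset_sum :: "'a rel \<Rightarrow> 'b rel \<Rightarrow> ('a + 'b) rel" where
  "poset_sum r s = {(Inl x, Inl y) |x y. (x, y) \<in> r} \<union> {(Inr x, Inr y) |x y. (x, y) \<in> s}"

definition chain_poset :: "nat \<Rightarrow> nat rel" where
  "chain_poset m = {(i, j). 1 \<le> i \<and> i \<le> j \<and> j \<le> m}"

definition one_element_poset :: "unit rel" where
  "one_element_poset = {((), ())}"

end

theory Submission
  imports Defs "HOL-Combinatorics.Permutations"
begin

text \<open>
  Let the poset be the disjoint union of \<open>A\<close> and \<open>B\<close>. Record for each entry of a linear extension
  only whether it lies in \<open>A\<close>. A Bender--Knuth move always swaps two adjacent letters of this
  word, because comparable neighbours carry equal letters, so the Hamming distance between the
  words of two linear extensions is invariant under the group. The full symmetric group is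
  doubly transitive, hence LE-symmetry forces this distance to be the same for all pairs of
  distinct linear extensions. The words \<open>A\<dots>AB\<dots>B\<close> and \<open>B\<dots>BA\<dots>A\<close> are at distance
  \<open>2 min(|A|, |B|)\<close>, swapping an adjacent \<open>A\<close> and \<open>B\<close> gives distance 2, and swapping two
  incomparable neighbours within \<open>A\<close> gives distance 0: so one part is a point, the other a chain.
  Conversely, for a chain plus a point a linear extension is the position of the point, and the
  moves are the adjacent transpositions of these positions.
\<close>

section \<open>Groups of bijections\<close>

lemma BijGroup_simps:
  "carrier (BijGroup S) = Bij S"
  "f \<in> Bij S \<Longrightarrow> g \<in> Bij S \<Longrightarrow> f \<otimes>\<^bsub>BijGroup S\<^esub> g = compose S f g"
  "\<one>\<^bsub>BijGroup S\<^esub> = restrict id S"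
  by (simp_all add: BijGroup_def id_def)

lemma Bij_mem: "f \<in> Bij S \<Longrightarrow> x \<in> S \<Longrightarrow> f x \<in> S"
  using Bij_imp_funcset by blast

lemma restrict_permutes_Bij: "p permutes S \<Longrightarrow> restrict p S \<in> Bij S"
  by (simp add: Bij_def permutes_imp_bij cong: bij_betw_cong)

lemma compose_restrict:
  "q permutes S \<Longrightarrow> compose S (restrict p S) (restrict q S) = restrict (p \<circ> q) S"
  by (rule ext) (simp add: compose_def permutes_in_image)

text \<open>Here \<open>d\<close> is an arbitrary two-place function. Taking it to be a Hamming
  distance lets invariance under the generating moves pass to the whole group they generate.
  Inverses preserve \<open>d\<close> by applying the hypothesis to preimages.\<close>

lemma isometries_subgroup:
  "subgroup {f \<in> Bij S. \<forall>x\<in>S. \<forall>y\<in>S. d (f x) (f y) = d x y} (BijGroup S)"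
    (is "subgroup ?K _")
proof (rule group.subgroupI[OF group_BijGroup])
  show "?K \<subseteq> carrier (BijGroup S)" by (auto simp: BijGroup_simps)
  have "(\<lambda>x\<in>S. x) \<in> ?K" by (simp add: id_Bij)
  then show "?K \<noteq> {}" by blast
next
  fix f assume f: "f \<in> ?K"
  then have fB: "f \<in> Bij S" and fd: "\<And>x y. x \<in> S \<Longrightarrow> y \<in> S \<Longrightarrow> d (f x) (f y) = d x y"
    by auto
  have "f (inv_into S f x) = x" if "x \<in> S" for x
    using fB that by (auto simp: Bij_def bij_betw_def f_inv_into_f)
  then have "d (inv_into S f x) (inv_into S f y) = d x y" if "x \<in> S" "y \<in> S" for x y
    using fd[of "inv_into S f x" "inv_into S f y"] that Bij_inv_into_mem[OF fB] by simp
  then show "inv\<^bsub>BijGroup S\<^esub> f \<in> ?K"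
    using fB by (simp add: inv_BijGroup restrict_inv_into_Bij)
next
  fix f g assume "f \<in> ?K" "g \<in> ?K"
  then show "f \<otimes>\<^bsub>BijGroup S\<^esub> g \<in> ?K"
    by (simp add: BijGroup_simps compose_Bij compose_eq Bij_mem)
qed

lemma Bij_doubly_transitive:
  assumes "x \<in> S" "y \<in> S" "u \<in> S" "v \<in> S" "x \<noteq> y" "u \<noteq> v"
  obtains f where "f \<in> Bij S" "f x = u" "f y = v"
proof
  \<comment> \<open>The inner transposition sends \<open>x\<close> to \<open>u\<close> and
    \<open>y\<close> to \<open>?y'\<close>. Neither \<open>?y'\<close> nor \<open>v\<close> equals
    \<open>u\<close>, so the outer one fixes \<open>u\<close> and sends \<open>?y'\<close> to
    \<open>v\<close>.\<close>
  let ?y' = "transpose x u y"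
  let ?p = "transpose ?y' v \<circ> transpose x u"
  have y': "?y' \<in> S" "?y' \<noteq> u"
    using assms by (auto simp: transpose_def)
  then have "?p permutes S"
    using assms by (intro permutes_compose permutes_swap_id)
  then show "restrict ?p S \<in> Bij S"
    by (rule restrict_permutes_Bij)
  show "restrict ?p S x = u" "restrict ?p S y = v"
    using assms y' by auto
qed

lemma subgroup_transpositions_eq_carrier:
  assumes fin: "finite S" and H: "subgroup H (BijGroup S)"
    and tr: "\<And>a b. a \<in> S \<Longrightarrow> b \<in> S \<Longrightarrow> restrict (transpose a b) S \<in> H"
  shows "H = carrier (BijGroup S)"
proof
  show "H \<subseteq> carrier (BijGroup S)" using H by (rule subgroup.subset)
next
  have *: "restrict p S \<in> H" if "p permutes S" for p
    using that fin
  proof (induction p rule: permutes_induct)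
    case id
    then show ?case
      using subgroup.one_closed[OF H] by (simp only: BijGroup_simps)
  next
    case (swap a b p)
    have "restrict (transpose a b) S \<otimes>\<^bsub>BijGroup S\<^esub> restrict p S \<in> H"
      using swap by (intro subgroup.m_closed[OF H] tr)
    then show ?case
      using swap
      by (simp add: BijGroup_simps restrict_permutes_Bij permutes_swap_id compose_restrict comp_def
          del: restrict_apply)
  qed
  show "carrier (BijGroup S) \<subseteq> H"
  proof
    fix f assume "f \<in> carrier (BijGroup S)"
    then have f: "bij_betw f S S" "f \<in> extensional S"
      by (auto simp: BijGroup_simps Bij_def)
    \<comment> \<open>Elements of \<open>Bij S\<close> are undefined outside \<open>S\<close>,
      whereas \<open>permutes\<close> requires the identity there; \<open>?p\<close> translates
      between the two conventions.\<close>
    let ?p = "\<lambda>x. if x \<in> S then f x else x"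
    have "bij_betw ?p S S" using f(1) by (simp cong: bij_betw_cong)
    then have "?p permutes S" by (rule bij_imp_permutes) simp
    then have "restrict ?p S \<in> H" by (rule *)
    moreover have "restrict ?p S = f"
      using f(2) by (auto simp: restrict_def extensional_def)
    ultimately show "f \<in> H" by simp
  qed
qed

text \<open>Conjugating by adjacent transpositions lengthens the gap between the two exchanged
  points one step at a time, which yields all transpositions.\<close>

lemma adjacent_transpositions_generate:
  fixes e :: "nat \<Rightarrow> 'b"
  assumes e: "inj_on e {..n}" and H: "subgroup H (BijGroup (e ` {..n}))"
    and adj: "\<And>k. k < n \<Longrightarrow> restrict (transpose (e k) (e (Suc k))) (e ` {..n}) \<in> H"
  shows "H = carrier (BijGroup (e ` {..n}))"
proof -
  let ?S = "e ` {..n}"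
  have diag: "restrict (transpose a a) ?S \<in> H" for a
    using subgroup.one_closed[OF H] by (simp only: BijGroup_simps transpose_same)
  have up: "restrict (transpose (e j) (e (j + m))) ?S \<in> H" if "j + m \<le> n" for j m
    using that
  proof (induction m)
    case 0
    then show ?case using diag by (simp add: id_def del: restrict_apply)
  next
    case (Suc m)
    show ?case
    \<comment> \<open>For \<open>m = 0\<close> the transposition to be conjugated degenerates to the
      identity, while the goal is an adjacent transposition itself.\<close>
    proof (cases "m = 0")
      case True
      then show ?thesis using adj Suc.prems by (simp del: restrict_apply)
    next
      case False
      let ?s = "transpose (e j) (e (j + m))"
      let ?t = "transpose (e (j + m)) (e (Suc (j + m)))"
      have ne: "e j \<noteq> e (j + m)" "e j \<noteq> e (Suc (j + m))" "e (j + m) \<noteq> e (Suc (j + m))"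
        using Suc.prems False by (auto simp: inj_on_eq_iff[OF e])
      have st: "?s permutes ?S" "?t permutes ?S"
        using Suc.prems by (auto intro!: permutes_swap_id)
      have sH: "restrict ?s ?S \<in> H" using Suc by (simp del: restrict_apply)
      have tH: "restrict ?t ?S \<in> H" using adj[of "j + m"] Suc.prems by simp
      have "restrict ?t ?S \<otimes>\<^bsub>BijGroup ?S\<^esub> (restrict ?s ?S \<otimes>\<^bsub>BijGroup ?S\<^esub> restrict ?t ?S) \<in> H"
        using sH tH by (intro subgroup.m_closed[OF H])
      moreover have "?t \<circ> (?s \<circ> ?t) = transpose (e j) (e (Suc (j + m)))"
        using ne by (auto simp: fun_eq_iff transpose_def)
      ultimately show ?thesis
        using st by (simp add: BijGroup_simps restrict_permutes_Bij compose_restrict permutes_compose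
            del: restrict_apply)
    qed
  qed
  have "restrict (transpose (e j) (e k)) ?S \<in> H" if "j \<le> n" "k \<le> n" for j k
  proof (cases "j \<le> k")
    case True
    then show ?thesis using up[of j "k - j"] that by simp
  next
    case False
    then show ?thesis using up[of k "j - k"] that by (simp add: transpose_commute)
  qed
  then show ?thesis
    by (intro subgroup_transpositions_eq_carrier H) auto
qed

section \<open>Linear extensions and Bender--Knuth moves\<close>

text \<open>In a list without repetitions, distinct entries mean distinct indices, so the order
  condition only forbids relations from a later entry to an earlier one. The form with
  \<open>sorted_wrt\<close> splits along \<open>@\<close> and passes to
  \<open>filter\<close>.\<close>

lemma linear_extensions_iff:
  "xs \<in> linear_extensions r \<longleftrightarrow>
     distinct xs \<and> set xs = Field r \<and> sorted_wrt (\<lambda>x y. (y, x) \<notin> r) xs"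
proof -
  have "(\<forall>a<length xs. \<forall>b<length xs. (xs ! a, xs ! b) \<in> r \<and> xs ! a \<noteq> xs ! b \<longrightarrow> a < b) \<longleftrightarrow>
    sorted_wrt (\<lambda>x y. (y, x) \<notin> r) xs" if "distinct xs"
  proof -
    have "xs ! a = xs ! b \<longleftrightarrow> a = b" if "a < length xs" "b < length xs" for a b
      using \<open>distinct xs\<close> that by (simp add: nth_eq_iff_index_eq)
    then show ?thesis
      unfolding sorted_wrt_iff_nth_less
      by (smt (verit) linorder_less_linear order.strict_trans less_not_sym)
  qed
  then show ?thesis by (auto simp: linear_extensions_def)
qed

lemma length_linear_extension: "xs \<in> linear_extensions r \<Longrightarrow> length xs = card (Field r)"
  by (metis distinct_card linear_extensions_iff)

lemma nth_swap:
  assumes "Suc p < length xs" "j < length xs"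
  shows "xs[p := xs ! Suc p, Suc p := xs ! p] ! j = xs ! transpose p (Suc p) j"
  using assms by (auto simp: nth_list_update transpose_def)

lemma swap_linear_extension:
  assumes xs: "xs \<in> linear_extensions r" and p: "Suc p < length xs"
    and inc: "incomparable r (xs ! p) (xs ! Suc p)"
  shows "xs[p := xs ! Suc p, Suc p := xs ! p] \<in> linear_extensions r" (is "?ys \<in> _")
proof -
  have d: "distinct ?ys" "set ?ys = Field r"
    using xs p by (simp_all add: linear_extensions_iff)
  have "(?ys ! b, ?ys ! a) \<notin> r" if ab: "a < b" "b < length xs" for a b
  proof (cases "a = p \<and> b = Suc p")
    case True
    then show ?thesis using inc p by (simp add: incomparable_def nth_list_update)
  next
    case False
    \<comment> \<open>An adjacent transposition of positions reverses no pair other than the swapped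
      one.\<close>
    then have "transpose p (Suc p) a < transpose p (Suc p) b" "transpose p (Suc p) b < length xs"
      using ab p by (auto simp: transpose_def)
    then have "(xs ! transpose p (Suc p) b, xs ! transpose p (Suc p) a) \<notin> r"
      using xs by (auto simp: linear_extensions_iff sorted_wrt_iff_nth_less)
    then show ?thesis
      using ab p by (simp add: nth_swap)
  qed
  then show ?thesis
    using d by (simp add: linear_extensions_iff sorted_wrt_iff_nth_less)
qed

lemma bender_knuth_apply:
  assumes "xs \<in> linear_extensions r"
  shows "bender_knuth r (Suc p) xs =
    (if incomparable r (xs ! p) (xs ! Suc p) then xs[p := xs ! Suc p, Suc p := xs ! p] else xs)"
  using assms by (simp add: bender_knuth_def)

lemma bender_knuth_mem:
  assumes "xs \<in> linear_extensions r" "Suc p < card (Field r)"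
  shows "bender_knuth r (Suc p) xs \<in> linear_extensions r"
  using assms swap_linear_extension[of xs r p]
  by (auto simp: bender_knuth_apply length_linear_extension)

lemma bender_knuth_involution:
  assumes xs: "xs \<in> linear_extensions r" and p: "Suc p < card (Field r)"
  shows "bender_knuth r (Suc p) (bender_knuth r (Suc p) xs) = xs"
proof (cases "incomparable r (xs ! p) (xs ! Suc p)")
  case True
  let ?ys = "xs[p := xs ! Suc p, Suc p := xs ! p]"
  have len: "Suc p < length xs" using xs p by (simp add: length_linear_extension)
  have ys: "?ys \<in> linear_extensions r" "incomparable r (?ys ! p) (?ys ! Suc p)"
    using swap_linear_extension[OF xs len True] True len by (auto simp: incomparable_def nth_list_update)
  have "?ys[p := ?ys ! Suc p, Suc p := ?ys ! p] = xs"
    using len by (auto intro!: nth_equalityI simp: nth_list_update)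
  then show ?thesis
    using xs ys True by (simp add: bender_knuth_apply)
next
  case False
  then show ?thesis using xs by (simp add: bender_knuth_apply)
qed

lemma bender_knuth_Bij:
  assumes "Suc p < card (Field r)"
  shows "bender_knuth r (Suc p) \<in> Bij (linear_extensions r)"
proof -
  have "bij_betw (bender_knuth r (Suc p)) (linear_extensions r) (linear_extensions r)"
    using assms bender_knuth_mem bender_knuth_involution
    by (intro bij_betw_byWitness[where f' = "bender_knuth r (Suc p)"]) blast+
  then show ?thesis by (simp add: Bij_def bender_knuth_def)
qed

text \<open>Reindexing by \<open>i = Suc p\<close> removes the truncated subtractions; both sides
  are empty when the field has at most one element.\<close>

lemma BK_generators:
  "{bender_knuth r i |i. 1 \<le> i \<and> i \<le> card (Field r) - 1} =
   {bender_knuth r (Suc p) |p. Suc p < card (Field r)}"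
proof (intro equalityI subsetI)
  fix f assume "f \<in> {bender_knuth r i |i. 1 \<le> i \<and> i \<le> card (Field r) - 1}"
  then obtain i where i: "f = bender_knuth r i" "1 \<le> i" "i \<le> card (Field r) - 1"
    by blast
  then have "f = bender_knuth r (Suc (i - 1))" "Suc (i - 1) < card (Field r)"
    by simp_all
  then show "f \<in> {bender_knuth r (Suc p) |p. Suc p < card (Field r)}" by blast
next
  fix f assume "f \<in> {bender_knuth r (Suc p) |p. Suc p < card (Field r)}"
  then obtain p where "f = bender_knuth r (Suc p)" "Suc p < card (Field r)" by blast
  then show "f \<in> {bender_knuth r i |i. 1 \<le> i \<and> i \<le> card (Field r) - 1}"
    by (intro CollectI exI[of _ "Suc p"]) simp
qed

lemma BK_group_subgroup: "subgroup (BK_group r) (BijGroup (linear_extensions r))"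
  unfolding BK_group_def BK_generators
  by (rule group.generate_is_subgroup[OF group_BijGroup])
     (auto simp: BijGroup_simps bender_knuth_Bij)

text \<open>The number of elements weakly below \<open>x\<close> increases strictly along the order,
  so sorting by it gives a linear extension.\<close>

lemma linear_extension_exists:
  assumes "Partial_order r" "finite (Field r)"
  obtains xs where "xs \<in> linear_extensions r"
proof -
  let ?f = "\<lambda>x. card {z. (z, x) \<in> r}"
  have mono: "?f x < ?f y" if xy: "(x, y) \<in> r" "x \<noteq> y" for x y
  proof (rule psubset_card_mono)
    show "finite {z. (z, y) \<in> r}"
      by (rule finite_subset[OF _ assms(2)]) (auto intro: FieldI1)
    have "trans r" "antisym r" "Refl r"
      using assms(1) by (auto simp: order_on_defs)
    moreover have "y \<in> Field r" using xy by (blast intro: FieldI2)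
    ultimately have "(y, y) \<in> r" "(y, x) \<notin> r"
      using xy by (auto dest: antisymD simp: refl_on_def)
    then show "{z. (z, x) \<in> r} \<subset> {z. (z, y) \<in> r}"
      using \<open>trans r\<close> xy by (auto dest: transD)
  qed
  obtain ys where ys: "set ys = Field r" "distinct ys"
    using finite_distinct_list[OF assms(2)] by blast
  let ?xs = "sort_key ?f ys"
  have s: "sorted (map ?f ?xs)" and d: "distinct ?xs"
    using ys by simp_all
  have "(?xs ! b, ?xs ! a) \<notin> r" if "a < b" "b < length ?xs" for a b
  proof -
    have "?f (?xs ! a) \<le> ?f (?xs ! b)"
      using sorted_nth_mono[OF s, of a b] that by simp
    moreover have "?xs ! a \<noteq> ?xs ! b"
      using that nth_eq_iff_index_eq[OF d, of a b] by simp
    ultimately show ?thesis using mono[of "?xs ! b" "?xs ! a"] by auto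
  qed
  then have "?xs \<in> linear_extensions r"
    using d ys by (simp add: linear_extensions_iff sorted_wrt_iff_nth_less)
  then show ?thesis using that by blast
qed

section \<open>Disconnected posets\<close>

locale split_poset =
  fixes r :: "'a rel" and A B :: "'a set"
  assumes po: "Partial_order r" and fin: "finite (Field r)"
    and ne: "A \<noteq> {}" "B \<noteq> {}" and disj: "A \<inter> B = {}" and un: "A \<union> B = Field r"
    and split: "r \<subseteq> A \<times> A \<union> B \<times> B"
begin

text \<open>The hypotheses are symmetric in the two parts, so a result about a singleton
  \<open>B\<close> also serves when \<open>A\<close> is the singleton.\<close>

lemma swapped: "split_poset r B A"
  using po fin ne disj un split by unfold_locales auto

lemma incomparable_parts: "x \<in> A \<Longrightarrow> y \<in> B \<Longrightarrow> incomparable r x y"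
  using split disj by (auto simp: incomparable_def)

section \<open>The invariant Hamming distance of shuffle words\<close>

definition shuffle_dist :: "'a list \<Rightarrow> 'a list \<Rightarrow> nat" where
  "shuffle_dist xs ys = card {j. j < card (Field r) \<and> (xs ! j \<in> A) \<noteq> (ys ! j \<in> A)}"

text \<open>On words the move always acts as the transposition of two places: when it fixes the
  list, the two neighbours are not incomparable, hence lie in the same part and carry equal
  letters.\<close>

lemma bender_knuth_nth_mem:
  assumes xs: "xs \<in> linear_extensions r" and p: "Suc p < card (Field r)"
    and j: "j < card (Field r)"
  shows "bender_knuth r (Suc p) xs ! j \<in> A \<longleftrightarrow> xs ! transpose p (Suc p) j \<in> A"
proof (cases "incomparable r (xs ! p) (xs ! Suc p)")
  case True
  then show ?thesis
    using assms by (simp add: bender_knuth_apply nth_swap length_linear_extension)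
next
  case False
  have "xs ! p \<in> Field r" "xs ! Suc p \<in> Field r"
    using xs p length_linear_extension[OF xs] nth_mem[of _ xs] by (auto simp: linear_extensions_iff)
  then have "xs ! p \<in> A \<longleftrightarrow> xs ! Suc p \<in> A"
    using False incomparable_parts un disj by (auto simp: incomparable_def)
  then show ?thesis
    using False xs by (auto simp: bender_knuth_apply transpose_def)
qed

text \<open>One and the same permutation of places acts on both words, so it carries the positions
  of disagreement bijectively to one another.\<close>

lemma shuffle_dist_bender_knuth:
  assumes xs: "xs \<in> linear_extensions r" and ys: "ys \<in> linear_extensions r"
    and p: "Suc p < card (Field r)"
  shows "shuffle_dist (bender_knuth r (Suc p) xs) (bender_knuth r (Suc p) ys) = shuffle_dist xs ys"
  unfolding shuffle_dist_def
proof (rule bij_betw_same_card)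
  let ?t = "transpose p (Suc p)"
  have t: "?t j < card (Field r) \<longleftrightarrow> j < card (Field r)" for j
    using p by (auto simp: transpose_def)
  show "bij_betw ?t
    {j. j < card (Field r) \<and>
        (bender_knuth r (Suc p) xs ! j \<in> A) \<noteq> (bender_knuth r (Suc p) ys ! j \<in> A)}
    {j. j < card (Field r) \<and> (xs ! j \<in> A) \<noteq> (ys ! j \<in> A)}"
    by (rule bij_betw_byWitness[where f' = ?t])
       (auto simp: t bender_knuth_nth_mem[OF xs p] bender_knuth_nth_mem[OF ys p])
qed

lemma shuffle_dist_BK_group:
  assumes "f \<in> BK_group r" "xs \<in> linear_extensions r" "ys \<in> linear_extensions r"
  shows "shuffle_dist (f xs) (f ys) = shuffle_dist xs ys"
proof -
  let ?L = "linear_extensions r"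
  have "BK_group r \<subseteq>
    {f \<in> Bij ?L. \<forall>x\<in>?L. \<forall>y\<in>?L. shuffle_dist (f x) (f y) = shuffle_dist x y}"
    unfolding BK_group_def BK_generators
    by (rule group.generate_subgroup_incl[OF group_BijGroup _ isometries_subgroup])
       (auto simp: bender_knuth_Bij shuffle_dist_bender_knuth)
  then show ?thesis using assms by blast
qed

section \<open>Consequences of LE-symmetry for the two parts\<close>

lemma LE_symmetric_shuffle_dist_eq:
  assumes "LE_symmetric r"
    and "xs \<in> linear_extensions r" "ys \<in> linear_extensions r" "xs \<noteq> ys"
    and "us \<in> linear_extensions r" "vs \<in> linear_extensions r" "us \<noteq> vs"
  shows "shuffle_dist xs ys = shuffle_dist us vs"
proof -
  obtain f where "f \<in> Bij (linear_extensions r)" "f xs = us" "f ys = vs"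
    using Bij_doubly_transitive assms by metis
  moreover from this have "f \<in> BK_group r"
    using assms(1) by (simp add: LE_symmetric_def BijGroup_simps)
  ultimately show ?thesis
    using shuffle_dist_BK_group assms by metis
qed

text \<open>Filtering one linear extension keeps the order inside each part, and no relation joins
  the parts, so the blocks may be concatenated either way.\<close>

lemma block_linear_extensions:
  obtains as bs where "distinct as" "distinct bs" "set as = A" "set bs = B"
    "as @ bs \<in> linear_extensions r" "bs @ as \<in> linear_extensions r"
proof -
  obtain xs where xs: "xs \<in> linear_extensions r"
    using linear_extension_exists[OF po fin] .
  let ?as = "filter (\<lambda>x. x \<in> A) xs" and ?bs = "filter (\<lambda>x. x \<in> B) xs"
  have "set ?as = A" "set ?bs = B" "distinct ?as" "distinct ?bs"
    using xs un by (auto simp: linear_extensions_iff)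
  moreover have "?as @ ?bs \<in> linear_extensions r" "?bs @ ?as \<in> linear_extensions r"
    using xs un disj split
    by (auto simp: linear_extensions_iff sorted_wrt_append sorted_wrt_filter)
  ultimately show ?thesis using that by blast
qed

lemma card_Field: "card (Field r) = card A + card B"
proof -
  have "finite A" "finite B" using fin un by (metis finite_Un)+
  then show ?thesis using card_Un_disjoint disj un by metis
qed

lemma LE_symmetric_part_singleton:
  assumes sym: "LE_symmetric r"
  shows "card A = 1 \<or> card B = 1"
proof (rule ccontr)
  assume not1: "\<not> (card A = 1 \<or> card B = 1)"
  have "finite A" "finite B" using fin un by (metis finite_Un)+
  then have ge2: "2 \<le> card A" "2 \<le> card B"
    using not1 ne by (metis One_nat_def Suc_leI card_gt_0_iff le_neq_implies_less one_add_one plus_1_eq_Suc)+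
  obtain as bs where ab: "distinct as" "distinct bs" "set as = A" "set bs = B"
    "as @ bs \<in> linear_extensions r" "bs @ as \<in> linear_extensions r"
    by (rule block_linear_extensions)
  have len: "length as = card A" "length bs = card B"
    using ab distinct_card by metis+
  have inA: "as ! i \<in> A" if "i < card A" for i using that ab(3) len nth_mem by metis
  have inB: "bs ! i \<in> B" if "i < card B" for i using that ab(4) len nth_mem by metis
  have nB: "x \<notin> A" if "x \<in> B" for x using that disj by blast
  let ?xs = "as @ bs" and ?ys = "bs @ as"
  \<comment> \<open>The last position of the \<open>A\<close>-block in \<open>as @ bs\<close>, so
    that the move swaps across the border of the blocks.\<close>
  define p where "p = card A - 1"
  have p: "Suc p < card (Field r)" using ge2 card_Field by (simp add: p_def)
  have "?xs ! p \<in> A" "?xs ! Suc p \<in> B"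
    using ge2 len inA inB by (simp_all add: nth_append p_def)
  then have inc: "incomparable r (?xs ! p) (?xs ! Suc p)" "?xs ! p \<noteq> ?xs ! Suc p"
    using incomparable_parts nB by auto
  let ?zs = "bender_knuth r (Suc p) ?xs"
  have zs: "?zs = ?xs[p := ?xs ! Suc p, Suc p := ?xs ! p]"
    using inc ab(5) by (simp add: bender_knuth_apply)
  have "?zs ! p = ?xs ! Suc p"
    unfolding zs using p len card_Field by simp
  then have "?xs \<noteq> ?zs" using inc by metis
  have "shuffle_dist ?xs ?zs \<le> card {p, Suc p}"
    unfolding shuffle_dist_def zs by (rule card_mono) (auto, metis nth_list_update_neq)
  also have "\<dots> = 2" by simp
  finally have two: "shuffle_dist ?xs ?zs \<le> 2" .
  have "?xs \<noteq> ?ys"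
    using inA[of 0] inB[of 0] nB ge2 len by (metis nth_append gr0I not_numeral_le_zero)
  then have "shuffle_dist ?xs ?ys = shuffle_dist ?xs ?zs"
    using LE_symmetric_shuffle_dist_eq[OF sym] ab \<open>?xs \<noteq> ?zs\<close> bender_knuth_mem[OF ab(5) p] by metis
  \<comment> \<open>With at least two elements in each part, the two block words disagree in the
    first two places and in the last one; three disagreements already exceed the bound 2.\<close>
  moreover have "card {0, 1, card A + card B - 1} \<le> shuffle_dist ?xs ?ys"
    unfolding shuffle_dist_def
  proof (rule card_mono)
    have "?xs ! i \<in> A" "?ys ! i \<in> B" if "i < 2" for i
      using that ge2 len inA inB by (simp_all add: nth_append)
    moreover have "?xs ! (card A + card B - 1) \<in> B" "?ys ! (card A + card B - 1) \<in> A"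
      using ge2 len inA inB by (auto simp: nth_append)
    ultimately show "{0, 1, card A + card B - 1} \<subseteq>
      {j. j < card (Field r) \<and> (?xs ! j \<in> A) \<noteq> (?ys ! j \<in> A)}"
      using ge2 nB card_Field by auto
  qed simp
  moreover have "card {0, 1, card A + card B - 1} = 3" using ge2 by simp
  ultimately show False using two by simp
qed

lemma LE_symmetric_block_chain:
  assumes sym: "LE_symmetric r"
    and ab: "set as = A" "set bs = B"
    and L: "as @ bs \<in> linear_extensions r" "bs @ as \<in> linear_extensions r"
  shows "sorted_wrt (\<lambda>x y. (x, y) \<in> r) as"
proof -
  let ?xs = "as @ bs" and ?ys = "bs @ as"
  have "trans r" using po by (simp add: order_on_defs)
  then have tr: "transp (\<lambda>x y. (x, y) \<in> r)" by (auto intro: transpI dest: transD)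
  \<comment> \<open>By transitivity it suffices to compare neighbours.\<close>
  have "(as ! i, as ! Suc i) \<in> r" if i: "Suc i < length as" for i
  proof (rule ccontr)
    assume not_le: "(as ! i, as ! Suc i) \<notin> r"
    have "sorted_wrt (\<lambda>x y. (y, x) \<notin> r) as" and ds: "distinct as"
      using L(1) by (simp_all add: linear_extensions_iff sorted_wrt_append)
    then have "(as ! Suc i, as ! i) \<notin> r"
      using i by (simp add: sorted_wrt_iff_nth_less)
    with not_le i have inc: "incomparable r (?xs ! i) (?xs ! Suc i)"
      by (simp add: incomparable_def nth_append)
    have p: "Suc i < length ?xs" using i by simp
    \<comment> \<open>Swapping two incomparable neighbours inside \<open>A\<close> changes the list
      but not its word, giving distance 0, while \<open>?xs\<close> and \<open>?ys\<close> already
      disagree in their first letter.\<close>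
    let ?zs = "?xs[i := ?xs ! Suc i, Suc i := ?xs ! i]"
    have zsL: "?zs \<in> linear_extensions r"
      by (rule swap_linear_extension[OF L(1) p inc])
    have "?zs ! i = as ! Suc i" "?xs ! i = as ! i" using i by (simp_all add: nth_append nth_list_update)
    then have "?xs \<noteq> ?zs" using ds i by (metis Suc_lessD n_not_Suc_n nth_eq_iff_index_eq)
    have "as ! i \<in> A" "as ! Suc i \<in> A" using i ab(1) by auto
    then have "?zs ! j \<in> A \<longleftrightarrow> ?xs ! j \<in> A" for j
      using i p by (cases "j = i \<or> j = Suc i") (auto simp: nth_list_update nth_append)
    then have "shuffle_dist ?xs ?zs = 0"
      by (simp add: shuffle_dist_def)
    moreover have "0 \<in> {j. j < card (Field r) \<and> (?xs ! j \<in> A) \<noteq> (?ys ! j \<in> A)}"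
    proof -
      have "as \<noteq> []" "bs \<noteq> []" using ab ne by auto
      then have "?xs ! 0 \<in> A" "?ys ! 0 \<in> B" using ab by (auto simp: nth_append)
      moreover have "0 < card (Field r)"
        using \<open>as \<noteq> []\<close> length_linear_extension[OF L(1)] by (metis append_is_Nil_conv length_greater_0_conv)
      ultimately show ?thesis using disj by auto
    qed
    then have "shuffle_dist ?xs ?ys > 0"
      unfolding shuffle_dist_def by (subst card_gt_0_iff) auto
    moreover from this have "?xs \<noteq> ?ys" by (auto simp: shuffle_dist_def)
    ultimately show False
      using LE_symmetric_shuffle_dist_eq[OF sym L \<open>?xs \<noteq> ?ys\<close> L(1) zsL \<open>?xs \<noteq> ?zs\<close>] by simp
  qed
  then show ?thesis
    using sorted_wrt_iff_nth_Suc_transp[OF tr] by blast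
qed

end

section \<open>A chain plus a point\<close>

text \<open>The isomorphism with the sum type is replaced by coordinates: \<open>c\<close> lists the
  chain in increasing order, and \<open>c \<noteq> []\<close> corresponds to
  \<open>n > 0\<close>.\<close>

definition chain_plus_point :: "'a rel \<Rightarrow> 'a list \<Rightarrow> 'a \<Rightarrow> bool" where
  "chain_plus_point r c z \<longleftrightarrow> c \<noteq> [] \<and> distinct (z # c) \<and> Field r = set (z # c) \<and>
     (\<forall>i<length c. \<forall>j<length c. (c ! i, c ! j) \<in> r \<longleftrightarrow> i \<le> j) \<and>
     (z, z) \<in> r \<and> (\<forall>x\<in>set c. incomparable r x z)"

lemma (in split_poset) LE_symmetric_chain_plus_point:
  assumes sym: "LE_symmetric r" and B: "card B = 1"
  shows "\<exists>c z. chain_plus_point r c z"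
proof -
  obtain z where z: "B = {z}" using B by (auto simp: card_1_singleton_iff)
  obtain as bs where ab: "distinct as" "set as = A" "set bs = B"
    "as @ bs \<in> linear_extensions r" "bs @ as \<in> linear_extensions r"
    using block_linear_extensions by metis
  have refl: "x \<in> Field r \<Longrightarrow> (x, x) \<in> r" for x
    using po by (auto simp: order_on_defs refl_on_def)
  have lt: "sorted_wrt (\<lambda>x y. (x, y) \<in> r) as" "sorted_wrt (\<lambda>x y. (y, x) \<notin> r) as"
    using LE_symmetric_block_chain[OF sym ab(2-)] ab(4)
    by (auto simp: linear_extensions_iff sorted_wrt_append)
  have "(as ! i, as ! j) \<in> r \<longleftrightarrow> i \<le> j" if ij: "i < length as" "j < length as" for i j
  proof (cases i j rule: linorder_cases)
    case equal
    then show ?thesis using refl[of "as ! i"] ij ab(2) un nth_mem by blast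
  qed (use lt ij in \<open>auto simp: sorted_wrt_iff_nth_less\<close>)
  then have "chain_plus_point r as z"
    unfolding chain_plus_point_def
    using ab ne disj un z refl[of z] incomparable_parts by auto
  then show ?thesis by blast
qed

lemma poset_iso_sym:
  assumes "poset_iso r s"
  shows "poset_iso s r"
proof -
  obtain f where f: "bij_betw f (Field r) (Field s)"
    and iff: "\<And>x y. x \<in> Field r \<Longrightarrow> y \<in> Field r \<Longrightarrow> (x, y) \<in> r \<longleftrightarrow> (f x, f y) \<in> s"
    using assms by (auto simp: poset_iso_def)
  let ?g = "inv_into (Field r) f"
  have g: "bij_betw ?g (Field s) (Field r)" by (rule bij_betw_inv_into[OF f])
  have "(x, y) \<in> s \<longleftrightarrow> (?g x, ?g y) \<in> r" if "x \<in> Field s" "y \<in> Field s" for x y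
    using iff[of "?g x" "?g y"] that bij_betwE[OF g] bij_betw_inv_into_right[OF f] by simp
  then show ?thesis using g by (auto simp: poset_iso_def)
qed

lemma Field_chain_plus_one:
  "Field (poset_sum (chain_poset n) one_element_poset) = Inl ` {1..n} \<union> {Inr ()}"
    (is "Field ?s = ?F")
proof
  show "Field ?s \<subseteq> ?F"
    by (auto simp: Field_def poset_sum_def chain_poset_def one_element_poset_def)
  have "(u, u) \<in> ?s" if "u \<in> ?F" for u
    using that by (auto simp: poset_sum_def chain_poset_def one_element_poset_def)
  then show "?F \<subseteq> Field ?s" by (blast intro: FieldI1)
qed

text \<open>Both directions use a map out of the standard poset, whose values on the chain form the
  list \<open>c\<close>; symmetry of isomorphism turns it around.\<close>

lemma poset_iso_chain_plus_one_iff: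
  "(\<exists>n>0. poset_iso r (poset_sum (chain_poset n) one_element_poset)) \<longleftrightarrow>
   (\<exists>c z. chain_plus_point r c z)"
proof
  assume "\<exists>n>0. poset_iso r (poset_sum (chain_poset n) one_element_poset)"
  then obtain n where n: "n > 0" and "poset_iso r (poset_sum (chain_poset n) one_element_poset)"
    by blast
  let ?s = "poset_sum (chain_poset n) one_element_poset"
  obtain g where g: "bij_betw g (Inl ` {1..n} \<union> {Inr ()}) (Field r)"
    and iff: "\<And>u v. u \<in> Inl ` {1..n} \<union> {Inr ()} \<Longrightarrow> v \<in> Inl ` {1..n} \<union> {Inr ()} \<Longrightarrow>
      (g u, g v) \<in> r \<longleftrightarrow> (u, v) \<in> ?s"
    using poset_iso_sym[OF \<open>poset_iso r ?s\<close>]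
    unfolding poset_iso_def Field_chain_plus_one by blast
  have inj: "inj_on g (Inl ` {1..n} \<union> {Inr ()})" using g by (rule bij_betw_imp_inj_on)
  \<comment> \<open>The standard chain starts at 1 but lists start at 0, hence the shift by
    \<open>Suc\<close>; the converse direction shifts back by \<open>i - 1\<close>.\<close>
  let ?c = "map (\<lambda>i. g (Inl (Suc i))) [0..<n]" and ?z = "g (Inr ())"
  have set_c: "set ?c = (\<lambda>i. g (Inl i)) ` {1..n}"
    using image_image[of "\<lambda>i. g (Inl i)" Suc "{..<n}"]
    by (simp add: atLeast0LessThan image_Suc_lessThan)
  have "?c \<noteq> []" using n by simp
  moreover have "distinct ?c"
    unfolding distinct_map by (auto intro!: inj_onI dest!: inj_onD[OF inj])
  moreover have "?z \<notin> set ?c"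
    unfolding set_c by (auto dest!: inj_onD[OF inj])
  moreover have "Field r = set (?z # ?c)"
    unfolding list.set set_c using bij_betw_imp_surj_on[OF g] by auto
  moreover have "(?c ! i, ?c ! j) \<in> r \<longleftrightarrow> i \<le> j" if "i < n" "j < n" for i j
    using that iff[of "Inl (Suc i)" "Inl (Suc j)"]
    by (auto simp: poset_sum_def chain_poset_def)
  moreover have "(?z, ?z) \<in> r"
    using iff[of "Inr ()" "Inr ()"] by (simp add: poset_sum_def one_element_poset_def)
  moreover have "incomparable r x ?z" if "x \<in> set ?c" for x
    using that iff[of _ "Inr ()"] iff[of "Inr ()"]
    unfolding set_c by (auto simp: incomparable_def poset_sum_def)
  ultimately have "chain_plus_point r ?c ?z"
    by (simp add: chain_plus_point_def)
  then show "\<exists>c z. chain_plus_point r c z" by blast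
next
  assume "\<exists>c z. chain_plus_point r c z"
  then obtain c z where cz: "chain_plus_point r c z" by blast
  let ?n = "length c"
  let ?s = "poset_sum (chain_poset ?n) one_element_poset"
  let ?h = "\<lambda>u. case u of Inl i \<Rightarrow> c ! (i - 1) | Inr (_::unit) \<Rightarrow> z"
  have c: "c \<noteq> []" "distinct c" "z \<notin> set c" "Field r = insert z (set c)" "(z, z) \<in> r"
    and ord: "\<And>i j. i < ?n \<Longrightarrow> j < ?n \<Longrightarrow> (c ! i, c ! j) \<in> r \<longleftrightarrow> i \<le> j"
    and inc: "\<And>i. i < ?n \<Longrightarrow> (c ! i, z) \<notin> r \<and> (z, c ! i) \<notin> r"
    using cz by (auto simp: chain_plus_point_def incomparable_def)
  have "inj_on ?h (Field ?s)"
    unfolding Field_chain_plus_one using c(2,3) nth_mem[of _ c]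
    by (auto simp: inj_on_def nth_eq_iff_index_eq)
  moreover have "?h ` Field ?s = Field r"
  proof -
    have "(\<lambda>i. c ! (i - 1)) ` {1..?n} = (!) c ` ((\<lambda>i. i - 1) ` Suc ` {..<?n})"
      by (simp add: image_Suc_lessThan image_image)
    also have "\<dots> = set c" by (simp add: image_image set_conv_nth lessThan_def setcompr_eq_image)
    finally show ?thesis
      unfolding Field_chain_plus_one c(4) by (simp add: image_Un image_image)
  qed
  moreover have "(u, v) \<in> ?s \<longleftrightarrow> (?h u, ?h v) \<in> r" if "u \<in> Field ?s" "v \<in> Field ?s" for u v
    using that c(5) inc ord unfolding Field_chain_plus_one
    by (auto simp: poset_sum_def chain_poset_def one_element_poset_def)
  ultimately have "poset_iso ?s r"
    unfolding poset_iso_def bij_betw_def by blast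
  then have "poset_iso r ?s" by (rule poset_iso_sym)
  then show "\<exists>n>0. poset_iso r (poset_sum (chain_poset n) one_element_poset)"
    using c(1) by blast
qed

section \<open>LE-symmetry of a chain plus a point\<close>

lemma chain_plus_point_LE_symmetric:
  assumes cz: "chain_plus_point r c z"
  shows "LE_symmetric r"
proof -
  let ?n = "length c"
  let ?L = "linear_extensions r"
  \<comment> \<open>The index of the point, from 0 to \<open>?n\<close>, serves as the coordinate on
    linear extensions.\<close>
  define e where "e k = take k c @ z # drop k c" for k
  have c: "distinct c" "z \<notin> set c" "Field r = insert z (set c)"
    and ord: "\<And>i j. i < ?n \<Longrightarrow> j < ?n \<Longrightarrow> (c ! i, c ! j) \<in> r \<longleftrightarrow> i \<le> j"
    and inc: "\<And>x. x \<in> set c \<Longrightarrow> incomparable r x z"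
    using cz by (auto simp: chain_plus_point_def)
  have card: "card (Field r) = Suc ?n"
    using c by (simp add: distinct_card)
  have e_nth: "e k ! j = (if j < k then c ! j else if j = k then z else c ! (j - 1))"
    if "k \<le> ?n" "j \<le> ?n" for k j
    using that by (auto simp: e_def nth_append nth_Cons')
  have len_e: "length (e k) = Suc ?n" for k by (simp add: e_def)
  have srt: "sorted_wrt (\<lambda>x y. (y, x) \<notin> r) c"
    using ord by (simp add: sorted_wrt_iff_nth_less)
  \<comment> \<open>Since \<open>z\<close> is incomparable to the chain, its position is
    unconstrained, and the condition concerns only the list with \<open>z\<close> removed.\<close>
  have L_iff: "us @ z # vs \<in> ?L \<longleftrightarrow>
      distinct (us @ vs) \<and> set (us @ vs) = set c \<and> sorted_wrt (\<lambda>x y. (y, x) \<notin> r) (us @ vs)" for us vs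
  proof -
    have "distinct (us @ z # vs) \<and> set (us @ z # vs) = Field r \<longleftrightarrow>
        z \<notin> set (us @ vs) \<and> distinct (us @ vs) \<and> insert z (set (us @ vs)) = insert z (set c)"
      using c(3) by auto
    also have "\<dots> \<longleftrightarrow> distinct (us @ vs) \<and> set (us @ vs) = set c"
      using c(2) by (metis insert_ident)
    finally show ?thesis
      using inc by (auto simp: linear_extensions_iff sorted_wrt_append incomparable_def)
  qed
  have L: "?L = e ` {..?n}"
  proof (intro equalityI subsetI)
    fix xs assume xs: "xs \<in> ?L"
    then have "z \<in> set xs" using c by (simp add: linear_extensions_iff)
    then obtain us vs where xs_eq: "xs = us @ z # vs" by (meson split_list)
    with xs have uv: "distinct (us @ vs)" "set (us @ vs) = set c"
      "sorted_wrt (\<lambda>x y. (y, x) \<notin> r) (us @ vs)"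
      by (auto simp: L_iff)
    \<comment> \<open>The rank in the chain serves as a sorting key: \<open>us @ vs\<close> and
      \<open>c\<close> have the same entries and strictly increasing keys, so they coincide.\<close>
    define idx where "idx x = (THE i. i < ?n \<and> c ! i = x)" for x
    have idx: "idx (c ! i) = i" if "i < ?n" for i
      unfolding idx_def using that c(1) by (auto simp: nth_eq_iff_index_eq)
    have "sorted (map idx ws)"
      if "set ws = set c" "sorted_wrt (\<lambda>x y. (y, x) \<notin> r) ws" for ws
    proof -
      have "idx x \<le> idx y" if "x \<in> set c" "y \<in> set c" "(y, x) \<notin> r" for x y
        using that ord idx by (metis in_set_conv_nth nat_le_linear)
      then show ?thesis
        unfolding sorted_map using that by (auto intro: sorted_wrt_mono_rel[rotated])
    qed
    then have "sorted (map idx (us @ vs))" "sorted (map idx c)"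
      using uv srt by blast+
    moreover have inj: "inj_on idx (set c)"
      using idx by (metis in_set_conv_nth inj_onI)
    moreover have "distinct (map idx (us @ vs))" "distinct (map idx c)"
      unfolding distinct_map uv(2) using uv(1) c(1) inj by blast+
    ultimately have "us @ vs = c"
      using uv(2) by (intro map_sorted_distinct_set_unique[where f = idx]) simp_all
    then have "xs = e (length us)" "length us \<le> ?n"
      unfolding xs_eq e_def by auto
    then show "xs \<in> e ` {..?n}" by blast
  next
    fix xs assume "xs \<in> e ` {..?n}"
    then obtain k where "xs = take k c @ z # drop k c" by (auto simp: e_def)
    then show "xs \<in> ?L" using c(1) srt by (simp only: L_iff append_take_drop_id)
  qed
  have inj: "inj_on e {..?n}"
  proof (rule linorder_inj_onI)
    fix j k assume jk: "j < k" "j \<in> {..?n}" "k \<in> {..?n}"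
    then have "e j ! j = z" "e k ! j \<in> set c" by (auto simp: e_nth)
    then show "e j \<noteq> e k" using c(2) by metis
  qed auto
  have bk: "bender_knuth r (Suc p) = restrict (transpose (e p) (e (Suc p))) ?L" if p: "p < ?n" for p
  proof
    fix xs
    show "bender_knuth r (Suc p) xs = restrict (transpose (e p) (e (Suc p))) ?L xs"
    proof (cases "xs \<in> ?L")
      case True
      then obtain k where k: "k \<le> ?n" "xs = e k" using L by auto
      have swap: "(e p)[p := e p ! Suc p, Suc p := e p ! p] = e (Suc p)"
        "(e (Suc p))[p := e (Suc p) ! Suc p, Suc p := e (Suc p) ! p] = e p"
        using p by (auto intro!: nth_equalityI simp: len_e e_nth nth_list_update)
      \<comment> \<open>In the first two cases the point is one of the two entries at
        \<open>p\<close> and \<open>Suc p\<close>, and the move exchanges \<open>e p\<close> with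
        \<open>e (Suc p)\<close>. Otherwise both entries belong to the chain and are comparable, so
        the list stays fixed, as it does under the transposition by injectivity of
        \<open>e\<close>.\<close>
      consider "k = p" | "k = Suc p" | "k < p" | "Suc p < k" by linarith
      then show ?thesis
      proof cases
        case 1
        then have "incomparable r (e k ! p) (e k ! Suc p)"
          using p inc[of "c ! p"] by (simp add: e_nth incomparable_def)
        then show ?thesis using True k(2) swap 1 by (simp add: bender_knuth_apply)
      next
        case 2
        then have "incomparable r (e k ! p) (e k ! Suc p)"
          using p inc[of "c ! p"] by (simp add: e_nth incomparable_def)
        then show ?thesis using True k(2) swap 2 by (simp add: bender_knuth_apply)
      next
        case 3
        then have "\<not> incomparable r (e k ! p) (e k ! Suc p)"
          using p k ord by (simp add: e_nth incomparable_def)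
        moreover have "e k \<noteq> e p" "e k \<noteq> e (Suc p)"
          using 3 p k by (auto simp: inj_on_eq_iff[OF inj])
        ultimately show ?thesis using True k(2) by (simp add: bender_knuth_apply)
      next
        case 4
        then have "\<not> incomparable r (e k ! p) (e k ! Suc p)"
          using p k ord by (simp add: e_nth incomparable_def)
        moreover have "e k \<noteq> e p" "e k \<noteq> e (Suc p)"
          using 4 p k by (auto simp: inj_on_eq_iff[OF inj])
        ultimately show ?thesis using True k(2) by (simp add: bender_knuth_apply)
      qed
    next
      case False
      then show ?thesis by (simp add: bender_knuth_def)
    qed
  qed
  have "bender_knuth r (Suc p) \<in> BK_group r" if "p < ?n" for p
    unfolding BK_group_def BK_generators using that card by (intro generate.incl) auto
  then have "BK_group r = carrier (BijGroup (e ` {..?n}))"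
    using BK_group_subgroup[of r] bk
    by (intro adjacent_transpositions_generate inj) (auto simp: L)
  then show ?thesis by (simp add: LE_symmetric_def L)
qed

theorem theorem4p12:
  fixes r :: "'a rel"
  assumes "Partial_order r"
    and "finite (Field r)"
    and "disconnected_poset r"
  shows "LE_symmetric r \<longleftrightarrow>
    (\<exists>n1::nat. n1 > 0 \<and> poset_iso r (poset_sum (chain_poset n1) one_element_poset))"
proof -
  obtain A B where "split_poset r A B"
    using assms by (auto simp: disconnected_poset_def split_poset_def)
  then interpret split_poset r A B .
  have "\<exists>c z. chain_plus_point r c z" if "LE_symmetric r"
    \<comment> \<open>If \<open>A\<close> is the singleton, the instance with the two parts
      exchanged applies.\<close>
    using LE_symmetric_part_singleton[OF that] LE_symmetric_chain_plus_point[OF that]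
      split_poset.LE_symmetric_chain_plus_point[OF swapped that] by blast
  then show ?thesis
    unfolding poset_iso_chain_plus_one_iff using chain_plus_point_LE_symmetric by metis
qed

end
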